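(* Let $k\geq 1$ and let $M$ be a set of $n\geq 2$ positive integers. For every tree $T\in\mathcal{T}_M(k)$ without young leaves, $\mathrm{oint}(T)=n-2\,\mathrm{oleaf}(T)$.
   Context: Trees: all trees are ordered (plane) rooted trees; the level of a node is its distance from the root (root at level 0); a leaf is a node with no children. An even $k$-ary tree is an ordered tree in which every node on an even level has exactly $k$ children. A pruned even $k$-ary tree is obtained from an even $k$-ary tree by deleting, for every even-level node all of whose children are leaves, all those children. An increasing pruned even $k$-ary tree on $M$ is a pruned even $k$-ary tree whose nodes on even levels are labeled bijectively by $M$ (odd-level nodes unlabeled) such that labels increase along every path from the root downward and, for each node, the labels of its children increase from left to right; $\mathcal{T}_M(k)$ is the set of them. A labeled node is a leaf if it has no children and an internal node otherwise. For a labeled node $v$, its grand parent is the labeled node $u$ such that a child of $u$ is the parent of $v$. A labeled non-root node $v$ is old if its label is the greatest among all grand children of its grand parent, and young otherwise; the root is neither. $\mathrm{oint}(T)$ is the number of old internal nodes and $\mathrm{oleaf}(T)$ the number of old leaves of $T$. *)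

theory Defs
  imports Main "HOL-Library.FuncSet" "HOL-Library.Sublist"
begin

datatype plane_tree = Node "plane_tree list"

text \<open>
  A node of a plane tree is represented by its address: the list of (0-based) child positions
  chosen on the path from the root. The root is \<open>[]\<close>, the children of \<open>p\<close> are, from left to
  right, \<open>p @ [0]\<close>, \<open>p @ [1]\<close>, \dots, and the level of \<open>p\<close> is \<open>length p\<close>.
\<close>

fun is_node :: "plane_tree \<Rightarrow> nat list \<Rightarrow> bool" where
  "is_node t [] \<longleftrightarrow> True"
| "is_node (Node ts) (i # p) \<longleftrightarrow> i < length ts \<and> is_node (ts ! i) p"

definition nodes :: "plane_tree \<Rightarrow> nat list set" where
  "nodes t = {p. is_node t p}"

definition level :: "nat list \<Rightarrow> nat" where
  "level p = length p"

definition children :: "plane_tree \<Rightarrow> nat list \<Rightarrow> nat list set" where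
  "children t p = {q \<in> nodes t. \<exists>i. q = p @ [i]}"

definition leaf :: "plane_tree \<Rightarrow> nat list \<Rightarrow> bool" where
  "leaf t p \<longleftrightarrow> p \<in> nodes t \<and> children t p = {}"

definition even_nodes :: "plane_tree \<Rightarrow> nat list set" where
  "even_nodes t = {p \<in> nodes t. even (level p)}"

definition even_kary :: "nat \<Rightarrow> plane_tree \<Rightarrow> bool" where
  "even_kary k t \<longleftrightarrow> (\<forall>p \<in> even_nodes t. card (children t p) = k)"

text \<open>
  Pruning always deletes all children of a node at once, and these are leaves, so the addresses of
  the remaining nodes do not change; a plane tree is determined by its set of addresses.
\<close>

definition pruning_of :: "plane_tree \<Rightarrow> plane_tree \<Rightarrow> bool" where
  "pruning_of s t \<longleftrightarrow>
     nodes t = nodes s - (\<Union>p \<in> {p \<in> even_nodes s. \<forall>c \<in> children s p. leaf s c}. children s p)"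

definition pruned_even_kary :: "nat \<Rightarrow> plane_tree \<Rightarrow> bool" where
  "pruned_even_kary k t \<longleftrightarrow> (\<exists>s. even_kary k s \<and> pruning_of s t)"

text \<open>
  A labeled tree is a pair of a plane tree and a labeling of its even-level nodes. Extensionality
  fixes the irrelevant values of the labeling, so that odd-level nodes carry no label.
\<close>

type_synonym labeled_tree = "plane_tree \<times> (nat list \<Rightarrow> nat)"

definition inc_pruned_trees :: "nat \<Rightarrow> nat set \<Rightarrow> labeled_tree set" where
  "inc_pruned_trees k M = {(t, l).
     pruned_even_kary k t \<and>
     l \<in> extensional (even_nodes t) \<and>
     bij_betw l (even_nodes t) M \<and>
     (\<forall>p \<in> even_nodes t. \<forall>q \<in> even_nodes t. strict_prefix p q \<longrightarrow> l p < l q) \<and>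
     (\<forall>p i j. p @ [i] \<in> even_nodes t \<longrightarrow> p @ [j] \<in> even_nodes t \<longrightarrow> i < j \<longrightarrow>
        l (p @ [i]) < l (p @ [j]))}"

definition grandchildren :: "plane_tree \<Rightarrow> nat list \<Rightarrow> nat list set" where
  "grandchildren t u = (\<Union>w \<in> children t u. children t w)"

definition old :: "labeled_tree \<Rightarrow> nat list \<Rightarrow> bool" where
  "old T v \<longleftrightarrow> (case T of (t, l) \<Rightarrow>
     v \<in> even_nodes t \<and> v \<noteq> [] \<and>
     (\<exists>u \<in> even_nodes t. v \<in> grandchildren t u \<and> (\<forall>w \<in> grandchildren t u. l w \<le> l v)))"

definition young :: "labeled_tree \<Rightarrow> nat list \<Rightarrow> bool" where
  "young T v \<longleftrightarrow> v \<in> even_nodes (fst T) \<and> v \<noteq> [] \<and> \<not> old T v"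

definition oint :: "labeled_tree \<Rightarrow> nat" where
  "oint T = card {v \<in> even_nodes (fst T). old T v \<and> \<not> leaf (fst T) v}"

definition oleaf :: "labeled_tree \<Rightarrow> nat" where
  "oleaf T = card {v \<in> even_nodes (fst T). old T v \<and> leaf (fst T) v}"

end

theory Submission
  imports Defs
begin

text \<open>
  In a pruned even \<open>k\<close>-ary tree every internal labeled node has a grandchild, and hence exactly one
  old grandchild. So the old nodes are equinumerous with the internal labeled nodes, and
  \<open>oint T + oleaf T\<close> is \<open>n\<close> minus the number of labeled leaves. Without young leaves, and with a
  root that is not a leaf, the labeled leaves are precisely the old leaves.
\<close>

lemma is_node_append_left: "is_node t (p @ q) \<Longrightarrow> is_node t p"
proof (induction p arbitrary: t)
  case (Cons i p)
  then show ?case by (cases t) auto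
qed simp

lemma in_children_iff: "q \<in> children t p \<longleftrightarrow> is_node t q \<and> (\<exists>i. q = p @ [i])"
  by (simp add: children_def nodes_def)

lemma in_even_nodes_iff: "p \<in> even_nodes t \<longleftrightarrow> is_node t p \<and> even (length p)"
  by (simp add: even_nodes_def nodes_def level_def)

lemma leaf_iff: "leaf t p \<longleftrightarrow> is_node t p \<and> (\<forall>i. \<not> is_node t (p @ [i]))"
  by (auto simp: leaf_def nodes_def children_def)

text \<open>The intermediate node \<open>u @ [i]\<close> needs no separate condition, because the
  nodes of a tree are closed under prefixes.\<close>

lemma in_grandchildren_iff:
  "v \<in> grandchildren t u \<longleftrightarrow> is_node t v \<and> (\<exists>i j. v = u @ [i, j])"
proof -
  have "is_node t (u @ [i])" if "is_node t (u @ [i, j])" for i j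
    using is_node_append_left[of t "u @ [i]" "[j]"] that by simp
  then show ?thesis
    by (auto simp: grandchildren_def in_children_iff)
qed

text \<open>A nonempty address would have its first entry as a prefix, and that prefix would be a
  child of the root. Used to exclude a leaf as root when there are at least two labels.\<close>

lemma even_nodes_root_leaf:
  assumes "leaf t []"
  shows "even_nodes t = {[]}"
proof -
  have "p = []" if "is_node t p" for p
  proof (cases p)
    case (Cons i q)
    then have "is_node t [i]" using is_node_append_left[of t "[i]" q] that by simp
    with assms show ?thesis by (simp add: leaf_iff)
  qed
  then show ?thesis by (auto simp: in_even_nodes_iff)
qed

text \<open>Pruning removes the children of \<open>p\<close> all together or not at all. A surviving
  child thus shows that \<open>p\<close> had a non-leaf child in the unpruned tree \<open>s\<close>,
  and the children of that child are never candidates for deletion.\<close>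

lemma pruned_internal_has_grandchild:
  assumes "pruned_even_kary k t" "p \<in> even_nodes t" "\<not> leaf t p"
  shows "grandchildren t p \<noteq> {}"
proof -
  obtain s where "pruning_of s t" using assms(1) by (auto simp: pruned_even_kary_def)
  then have nodes_t: "nodes t =
      nodes s - (\<Union>p \<in> {p \<in> even_nodes s. \<forall>c \<in> children s p. leaf s c}. children s p)"
    by (simp add: pruning_of_def)
  have sub: "is_node s q" if "is_node t q" for q
    using that nodes_t by (auto simp: nodes_def)
  have kept: "is_node t q"
    if "is_node s q"
      and "\<And>u. u \<in> even_nodes s \<Longrightarrow> q \<in> children s u \<Longrightarrow> \<exists>c \<in> children s u. \<not> leaf s c" for q
    using that nodes_t unfolding nodes_def by blast
  obtain i where i: "is_node t (p @ [i])"
    using assms(2,3) by (auto simp: leaf_iff in_even_nodes_iff)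
  have p: "p \<in> even_nodes s" using assms(2) sub by (simp add: in_even_nodes_iff)
  have "p @ [i] \<in> children s p" using sub[OF i] by (simp add: in_children_iff)
  moreover have "p @ [i] \<in> nodes t" using i by (simp add: nodes_def)
  \<comment> \<open>If all children of \<open>p\<close> were leaves of \<open>s\<close>, then
    \<open>p @ [i]\<close> would have been deleted.\<close>
  ultimately have "\<not> (\<forall>c \<in> children s p. leaf s c)" using nodes_t p by blast
  then obtain j where j: "is_node s (p @ [j])" "\<not> leaf s (p @ [j])"
    by (auto simp: in_children_iff)
  then obtain m where m: "is_node s (p @ [j, m])"
    by (auto simp: leaf_iff)
  \<comment> \<open>Only children of even-level nodes are pruned, so this even-level node survives.\<close>
  have "is_node t (p @ [j, m])"
  proof (rule kept[OF m])
    fix u assume "u \<in> even_nodes s" "p @ [j, m] \<in> children s u"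
    then have "even (length u)" "u = p @ [j]"
      by (auto simp: in_even_nodes_iff in_children_iff)
    with p show "\<exists>c \<in> children s u. \<not> leaf s c" by (simp add: in_even_nodes_iff)
  qed
  then have "p @ [j, m] \<in> grandchildren t p" by (simp add: in_grandchildren_iff)
  then show ?thesis by blast
qed

text \<open>Dropping the last two entries of an address yields the grand parent. The inverse map
  picks the grandchild with the greatest label: it exists since an internal node has a nonempty
  finite set of grandchildren, and it is unique since \<open>l\<close> is injective.\<close>

lemma bij_betw_old_internal:
  assumes pruned: "pruned_even_kary k t"
    and fin: "finite (even_nodes t)"
    and inj: "inj_on l (even_nodes t)"
  shows "bij_betw (butlast \<circ> butlast) {v \<in> even_nodes t. old (t, l) v}
           {u \<in> even_nodes t. \<not> leaf t u}"
proof (rule bij_betw_imageI)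
  \<comment> \<open>The existential witness in \<open>old\<close> is determined by the address of
    \<open>v\<close>, so it can be replaced by a function of \<open>v\<close>.\<close>
  have gp: "butlast (butlast v) \<in> even_nodes t \<and> v \<in> grandchildren t (butlast (butlast v)) \<and>
      (\<forall>w \<in> grandchildren t (butlast (butlast v)). l w \<le> l v)" if "old (t, l) v" for v
  proof -
    obtain u where u: "u \<in> even_nodes t" "v \<in> grandchildren t u"
      "\<forall>w \<in> grandchildren t u. l w \<le> l v"
      using \<open>old (t, l) v\<close> by (auto simp: old_def)
    then have "butlast (butlast v) = u"
      by (auto simp: in_grandchildren_iff butlast_append)
    with u show ?thesis by simp
  qed
  show "inj_on (butlast \<circ> butlast) {v \<in> even_nodes t. old (t, l) v}"
  proof (rule inj_onI)
    fix v w
    assume v: "v \<in> {v \<in> even_nodes t. old (t, l) v}"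
      and w: "w \<in> {v \<in> even_nodes t. old (t, l) v}"
      and eq: "(butlast \<circ> butlast) v = (butlast \<circ> butlast) w"
    \<comment> \<open>Both nodes are maximal among the same grandchildren, so each label bounds the
      other.\<close>
    then have "l v = l w" using gp[of v] gp[of w] by (auto intro!: antisym)
    then show "v = w" using v w inj by (auto dest: inj_onD)
  qed
  show "(butlast \<circ> butlast) ` {v \<in> even_nodes t. old (t, l) v} = {u \<in> even_nodes t. \<not> leaf t u}"
  proof (intro equalityI subsetI)
    fix u assume "u \<in> (butlast \<circ> butlast) ` {v \<in> even_nodes t. old (t, l) v}"
    then obtain v where "old (t, l) v" "u = butlast (butlast v)" by auto
    with gp[of v] show "u \<in> {u \<in> even_nodes t. \<not> leaf t u}"
      by (auto simp: leaf_def grandchildren_def)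
  next
    fix u assume u: "u \<in> {u \<in> even_nodes t. \<not> leaf t u}"
    let ?G = "grandchildren t u"
    have sub: "?G \<subseteq> even_nodes t"
      using u by (auto simp: in_grandchildren_iff in_even_nodes_iff)
    have G: "finite (l ` ?G)" "l ` ?G \<noteq> {}"
      using finite_subset[OF sub fin] pruned_internal_has_grandchild[OF pruned] u by auto
    obtain v where v: "v \<in> ?G" "l v = Max (l ` ?G)"
      using Max_in[OF G] by auto
    then have "\<forall>w \<in> ?G. l w \<le> l v" using G by simp
    moreover have "v \<noteq> []" "butlast (butlast v) = u"
      using v by (auto simp: in_grandchildren_iff butlast_append)
    ultimately show "u \<in> (butlast \<circ> butlast) ` {v \<in> even_nodes t. old (t, l) v}"
      using v sub u by (auto simp: old_def intro!: image_eqI[where x = v])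
  qed
qed

theorem lemma4p3:
  fixes k n :: nat and M :: "nat set" and T :: labeled_tree
  assumes "k \<ge> 1"
    and "\<forall>m \<in> M. m > 0"
    and "card M = n"
    and "n \<ge> 2"
    and "T \<in> inc_pruned_trees k M"
    and "\<not> (\<exists>v. young T v \<and> leaf (fst T) v)"
  shows "int (oint T) = int n - 2 * int (oleaf T)"
proof -
  obtain t l where T: "T = (t, l)" by (cases T)
  let ?E = "even_nodes t"
  have pruned: "pruned_even_kary k t" and bij: "bij_betw l ?E M"
    using assms(5) by (auto simp: T inc_pruned_trees_def)
  have card_E: "card ?E = n" using bij_betw_same_card[OF bij] assms(3) by simp
  \<comment> \<open>An infinite set has \<open>card\<close> 0, so a cardinality of at least 2 forces
    finiteness.\<close>
  then have fin: "finite ?E" using assms(4) by (auto intro: card_ge_0_finite)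
  have "\<not> leaf t []"
  proof
    assume "leaf t []"
    then have "card ?E = 1" by (simp add: even_nodes_root_leaf)
    with card_E assms(4) show False by linarith
  qed
  then have leaves: "{v \<in> ?E. old T v \<and> leaf t v} = {v \<in> ?E. leaf t v}"
    using assms(6) by (auto simp: T young_def)
  have "card {v \<in> ?E. old T v} = card {u \<in> ?E. \<not> leaf t u}"
    using bij_betw_same_card[OF bij_betw_old_internal[OF pruned fin bij_betw_imp_inj_on[OF bij]]]
    by (simp add: T)
  moreover have "card {v \<in> ?E. old T v} = oint T + oleaf T"
  proof -
    have "{v \<in> ?E. old T v} = {v \<in> ?E. old T v \<and> \<not> leaf t v} \<union> {v \<in> ?E. old T v \<and> leaf t v}"
      by blast
    also have "card \<dots> = oint T + oleaf T"
      unfolding oint_def oleaf_def T fst_conv using fin by (intro card_Un_disjoint) auto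
    finally show ?thesis .
  qed
  moreover have "card ?E = card {u \<in> ?E. \<not> leaf t u} + card {v \<in> ?E. leaf t v}"
  proof -
    have "?E = {u \<in> ?E. \<not> leaf t u} \<union> {v \<in> ?E. leaf t v}" by blast
    also have "card \<dots> = card {u \<in> ?E. \<not> leaf t u} + card {v \<in> ?E. leaf t v}"
      using fin by (intro card_Un_disjoint) auto
    finally show ?thesis .
  qed
  \<comment> \<open>With I internal labeled nodes, I = \<open>oint T + oleaf T\<close> and n = I +
    \<open>oleaf T\<close>; eliminating I gives the claim.\<close>
  ultimately show ?thesis
    using card_E leaves by (simp add: oleaf_def T)
qed

end
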